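(* Let $R$ be an associative ring with identity, let $x_1\neq x_2$ be elements of $R$, and let $n\ge 2$ be an integer. If at least one of the elements $$x_1-x_2,\quad x_1^2-x_2^2,\quad \dots,\quad x_1^{n-1}-x_2^{n-1}$$ is invertible in $R$, then there exist $a_0,a_1,\dots,a_{n-1}\in R$ such that both $x_1$ and $x_2$ are solutions of the equation $$x^n+a_{n-1}x^{n-1}+\dots+a_1x+a_0=0 .$$
   Context: $R$ is not necessarily commutative. Polynomials are evaluated with coefficients on the left: an element $b\in R$ is a solution of the equation $x^n+a_{n-1}x^{n-1}+\dots+a_1x+a_0=0$ if $b^n+a_{n-1}b^{n-1}+\dots+a_1b+a_0=0$ in $R$. *)

theory Defs
  imports "HOL-Algebra.Ring"
begin

end

theory Submission
  imports Defs
begin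

text \<open>
  Only two coefficients besides the leading one are required. If \<open>d = x1\<^sup>k - x2\<^sup>k\<close> is
  a unit, look for an equation \<open>x\<^sup>n + b x\<^sup>k + c = 0\<close>. Subtracting its instances at
  \<open>x1\<close> and \<open>x2\<close> eliminates \<open>c\<close> and leaves \<open>b d = -(x1\<^sup>n - x2\<^sup>n)\<close>, which is solved by
  \<open>b = -(x1\<^sup>n - x2\<^sup>n) d\<inverse>\<close>; since coefficients stand on the left, a right cancellation of
  \<open>d\<close> is all that non-commutativity demands. The constant \<open>c\<close> is then
  whatever makes \<open>x1\<close> a root, and \<open>x2\<close> is a root by the choice of \<open>b\<close>.
\<close>

lemma (in abelian_monoid) finsum_two_terms:
  assumes "finite A" "i \<in> A" "j \<in> A" "i \<noteq> j"
    and "f i \<in> carrier G" "f j \<in> carrier G"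
    and zero: "\<And>l. l \<in> A \<Longrightarrow> l \<noteq> i \<Longrightarrow> l \<noteq> j \<Longrightarrow> f l = \<zero>"
  shows "finsum G f A = f i \<oplus> f j"
proof -
  define B where "B = A - {i, j}"
  have A: "A = insert i (insert j B)" and B: "finite B" "i \<notin> insert j B" "j \<notin> B"
    using assms(1-4) by (auto simp: B_def)
  have fB: "f l = \<zero>" if "l \<in> B" for l
    using that zero by (auto simp: B_def)
  have "finsum G f B = \<zero>"
    using fB by (rule add.finprod_one_eqI)
  then show ?thesis
    unfolding A using B fB assms(5,6)
    by (subst finsum_insert; (subst finsum_insert)?) (auto simp: Pi_def)
qed

text \<open>
  The interpolation step for the two free coefficients: the elements \<open>p\<close>, \<open>q\<close> stand for the
  \<open>k\<close>-th powers of the two prescribed roots and \<open>u\<close>, \<open>v\<close> for their \<open>n\<close>-th powers.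
\<close>
lemma (in ring) ex_common_affine_relation:
  assumes carr: "p \<in> carrier R" "q \<in> carrier R" "u \<in> carrier R" "v \<in> carrier R"
    and unit: "p \<ominus> q \<in> Units R"
  obtains b c where "b \<in> carrier R" "c \<in> carrier R"
    "u \<oplus> (c \<oplus> b \<otimes> p) = \<zero>" "v \<oplus> (c \<oplus> b \<otimes> q) = \<zero>"
proof -
  define b where "b = \<ominus> ((u \<ominus> v) \<otimes> inv (p \<ominus> q))"
  define c where "c = \<ominus> (u \<oplus> b \<otimes> p)"
  have inv: "inv (p \<ominus> q) \<in> carrier R"
    using unit by simp
  have b: "b \<in> carrier R" and c: "c \<in> carrier R"
    using carr inv by (simp_all add: b_def c_def)
  have "b \<otimes> (p \<ominus> q) = \<ominus> ((u \<ominus> v) \<otimes> (inv (p \<ominus> q) \<otimes> (p \<ominus> q)))"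
    using carr inv by (simp add: b_def l_minus m_assoc)
  also have "\<dots> = \<ominus> (u \<ominus> v)"
    using carr unit by simp
  finally have "b \<otimes> p \<ominus> b \<otimes> q = \<ominus> (u \<ominus> v)"
    using carr b by (simp add: minus_eq r_distr r_minus)
  then have bp: "b \<otimes> p = \<ominus> (u \<ominus> v) \<oplus> b \<otimes> q"
    using carr b by (metis add.inv_solve_right' a_minus_def m_closed minus_closed add.inv_closed)
  have "u \<oplus> (c \<oplus> b \<otimes> p) = (u \<oplus> b \<otimes> p) \<oplus> c"
    using carr b c by (simp add: a_ac)
  then have root_u: "u \<oplus> (c \<oplus> b \<otimes> p) = \<zero>"
    using carr b by (simp add: c_def r_neg)
  have "v \<oplus> b \<otimes> q = u \<oplus> b \<otimes> p"
  proof -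
    have "u \<oplus> b \<otimes> p = u \<oplus> (\<ominus> u \<oplus> (v \<oplus> b \<otimes> q))"
      unfolding bp using carr b by (simp add: minus_eq minus_add a_assoc)
    then show ?thesis
      using carr b by (simp add: r_neg2)
  qed
  moreover have "v \<oplus> (c \<oplus> b \<otimes> q) = (v \<oplus> b \<otimes> q) \<oplus> c"
    using carr b c by (simp add: a_ac)
  ultimately have "v \<oplus> (c \<oplus> b \<otimes> q) = \<zero>"
    using carr b by (simp add: c_def r_neg)
  with b c root_u show thesis
    by (rule that)
qed

theorem theorem3:
  fixes R (structure) and x1 x2 :: 'a and n :: nat
  assumes "ring R"
    and "x1 \<in> carrier R" and "x2 \<in> carrier R" and "x1 \<noteq> x2"
    and "n \<ge> 2"
    and "\<exists>k\<in>{1..n - 1}. x1 [^] k \<ominus> x2 [^] k \<in> Units R"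
  shows "\<exists>a \<in> {0..n - 1} \<rightarrow> carrier R.
           x1 [^] n \<oplus> (\<Oplus>i\<in>{0..n - 1}. a i \<otimes> x1 [^] i) = \<zero> \<and>
           x2 [^] n \<oplus> (\<Oplus>i\<in>{0..n - 1}. a i \<otimes> x2 [^] i) = \<zero>"
proof -
  interpret ring R by fact
  obtain k where k: "k \<in> {1..n - 1}" and unit: "x1 [^] k \<ominus> x2 [^] k \<in> Units R"
    using assms(6) by blast
  obtain b c where b: "b \<in> carrier R" and c: "c \<in> carrier R"
    and roots: "x1 [^] n \<oplus> (c \<oplus> b \<otimes> x1 [^] k) = \<zero>"
      "x2 [^] n \<oplus> (c \<oplus> b \<otimes> x2 [^] k) = \<zero>"
    using ex_common_affine_relation[OF _ _ _ _ unit, of "x1 [^] n" "x2 [^] n"] assms(2,3)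
    by auto
  define a where "a i = (if i = 0 then c else if i = k then b else \<zero>)" for i
  have a: "a \<in> {0..n - 1} \<rightarrow> carrier R"
    using b c by (auto simp: a_def)
  have eval: "(\<Oplus>i\<in>{0..n - 1}. a i \<otimes> x [^] i) = c \<oplus> b \<otimes> x [^] k"
    if x: "x \<in> carrier R" for x
    using finsum_two_terms[of "{0..n - 1}" 0 k "\<lambda>i. a i \<otimes> x [^] i"] k b c x
    by (auto simp: a_def)
  show ?thesis
    using a roots by (intro bexI[of _ a]) (simp_all only: eval assms(2,3) simp_thms)
qed

end
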